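(* Suppose $\mathbf{C}$ is a defender Strong Stackelberg Equilibrium strategy in a security game which satisfies the SSAS property. Then $E(\mathbf{C})=E^*$; that is, $\Omega_{SSE}\subseteq\Omega_M=\Omega_{NE}$.
   Context: A security game is a two-player game between a defender and an attacker, given by: a finite nonempty set of targets $T=\{t_1,\dots,t_n\}$; defender resources $r_1,\dots,r_K$; for each resource $r_i$ a nonempty set $S_i$ of schedules that $r_i$ can cover, each schedule being a subset of $T$; and for each target $t$ real payoffs $U_d^c(t),U_d^u(t)$ (defender, $t$ attacked while covered/uncovered) and $U_a^c(t),U_a^u(t)$ (attacker), such that $\Delta U_d(t):=U_d^c(t)-U_d^u(t)>0$ and $\Delta U_a(t):=U_a^u(t)-U_a^c(t)>0$. A defender pure strategy is an assignment $(s_1,\dots,s_K)\in\prod_{i=1}^K S_i$, represented by its coverage vector $\mathbf{d}\in\{0,1\}^n$ with $d_j=1$ iff $t_j\in\bigcup_i s_i$. Let $\mathcal{D}\subseteq\{0,1\}^n$ be the set of coverage vectors arising in this way. A defender (mixed) strategy $\mathbf{C}=(C_{\mathbf{d}})_{\mathbf{d}\in\mathcal{D}}$ is a probability distribution on $\mathcal{D}$; its vector of marginal coverage probabilities is $\mathbf{c}=\varphi(\mathbf{C})$, $c_i=\sum_{\mathbf{d}\in\mathcal{D}} d_iC_{\mathbf{d}}$. An attacker (mixed) strategy $\mathbf{a}=(a_i)$ is a probability distribution on $T$. Utilities are $$U_d(\mathbf{C},\mathbf{a})=\sum_{i=1}^n a_i\big(c_iU_d^c(t_i)+(1-c_i)U_d^u(t_i)\big),\qquad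 U_a(\mathbf{C},\mathbf{a})=\sum_{i=1}^n a_i\big(c_iU_a^c(t_i)+(1-c_i)U_a^u(t_i)\big),$$ and $U_a(\mathbf{C},t_i)$, $U_d(\mathbf{C},t_i)$ denote the utilities when $t_i$ is attacked with probability 1. The SSAS property (Subsets of Schedules Are Schedules): for every $1\le i\le K$, if $s\in S_i$ and $s'\subseteq s$, then $s'\in S_i$. Nash equilibrium (NE): $\langle\mathbf{C},\mathbf{a}\rangle$ with $U_d(\mathbf{C},\mathbf{a})\ge U_d(\mathbf{C}',\mathbf{a})$ for all $\mathbf{C}'$ and $U_a(\mathbf{C},\mathbf{a})\ge U_a(\mathbf{C},\mathbf{a}')$ for all $\mathbf{a}'$. Strong Stackelberg Equilibrium (SSE): a pair $\langle\mathbf{C},g\rangle$, where $g$ maps each defender strategy to an attacker strategy, such that (1) $U_d(\mathbf{C},g(\mathbf{C}))\ge U_d(\mathbf{C}',g(\mathbf{C}'))$ for all $\mathbf{C}'$; (2) for every defender strategy $\mathbf{C}'$, $g(\mathbf{C}')$ is an attacker best response to $\mathbf{C}'$; (3) for every defender strategy $\mathbf{C}'$ and every attacker best response $\mathbf{a}$ to $\mathbf{C}'$, $U_d(\mathbf{C}',g(\mathbf{C}'))\ge U_d(\mathbf{C}',\mathbf{a})$. $\Omega_{NE}$ (resp. $\Omega_{SSE}$) is the set of defender strategies $\mathbf{C}$ that are played in some NE (resp. some SSE). The attacker's best-response utility is $E(\mathbf{C})=\max_{1\le i\le n}U_a(\mathbf{C},t_i)$, $E^*=\min_{\mathbf{C}}E(\mathbf{C})$,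 and $\Omega_M=\{\mathbf{C}: E(\mathbf{C})=E^*\}$ is the set of defender minimax strategies. *)

theory Defs
  imports "HOL-Probability.Probability"
begin

record 'a game =
  targets :: "'a set"
  num_resources :: nat
  schedules :: "nat \<Rightarrow> 'a set set"
  def_cov :: "'a \<Rightarrow> real"
  def_unc :: "'a \<Rightarrow> real"
  att_cov :: "'a \<Rightarrow> real"
  att_unc :: "'a \<Rightarrow> real"

definition security_game :: "'a game \<Rightarrow> bool" where
  "security_game G \<longleftrightarrow>
     finite (targets G) \<and> targets G \<noteq> {} \<and>
     (\<forall>i\<in>{1..num_resources G}. schedules G i \<noteq> {} \<and> (\<forall>s\<in>schedules G i. s \<subseteq> targets G)) \<and>
     (\<forall>t\<in>targets G. def_cov G t - def_unc G t > 0 \<and> att_unc G t - att_cov G t > 0)"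

definition SSAS :: "'a game \<Rightarrow> bool" where
  "SSAS G \<longleftrightarrow>
     (\<forall>i\<in>{1..num_resources G}. \<forall>s s'. s \<in> schedules G i \<longrightarrow> s' \<subseteq> s \<longrightarrow> s' \<in> schedules G i)"

text \<open>A vector of \<open>{0,1}\<^sup>n\<close> is a function on targets. In a security game every schedule is a
  set of targets, so the coverage vectors vanish outside the set of targets.\<close>

definition coverage_vectors :: "'a game \<Rightarrow> ('a \<Rightarrow> real) set" where
  "coverage_vectors G =
     {indicator (\<Union>i\<in>{1..num_resources G}. s i) | s. \<forall>i\<in>{1..num_resources G}. s i \<in> schedules G i}"

definition def_strategies :: "'a game \<Rightarrow> ('a \<Rightarrow> real) pmf set" where
  "def_strategies G = {C. set_pmf C \<subseteq> coverage_vectors G}"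

definition att_strategies :: "'a game \<Rightarrow> 'a pmf set" where
  "att_strategies G = {a. set_pmf a \<subseteq> targets G}"

definition marginal :: "'a game \<Rightarrow> ('a \<Rightarrow> real) pmf \<Rightarrow> 'a \<Rightarrow> real" where
  "marginal G C t = (\<Sum>d\<in>coverage_vectors G. d t * pmf C d)"

definition U_d :: "'a game \<Rightarrow> ('a \<Rightarrow> real) pmf \<Rightarrow> 'a pmf \<Rightarrow> real" where
  "U_d G C a =
     (\<Sum>t\<in>targets G. pmf a t * (marginal G C t * def_cov G t + (1 - marginal G C t) * def_unc G t))"

definition U_a :: "'a game \<Rightarrow> ('a \<Rightarrow> real) pmf \<Rightarrow> 'a pmf \<Rightarrow> real" where
  "U_a G C a =
     (\<Sum>t\<in>targets G. pmf a t * (marginal G C t * att_cov G t + (1 - marginal G C t) * att_unc G t))"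

definition att_best_response :: "'a game \<Rightarrow> ('a \<Rightarrow> real) pmf \<Rightarrow> 'a pmf \<Rightarrow> bool" where
  "att_best_response G C a \<longleftrightarrow>
     a \<in> att_strategies G \<and> (\<forall>a'\<in>att_strategies G. U_a G C a \<ge> U_a G C a')"

definition NE :: "'a game \<Rightarrow> ('a \<Rightarrow> real) pmf \<Rightarrow> 'a pmf \<Rightarrow> bool" where
  "NE G C a \<longleftrightarrow>
     C \<in> def_strategies G \<and> a \<in> att_strategies G \<and>
     (\<forall>C'\<in>def_strategies G. U_d G C a \<ge> U_d G C' a) \<and>
     (\<forall>a'\<in>att_strategies G. U_a G C a \<ge> U_a G C a')"

text \<open>The response function \<open>g\<close> is total in HOL; only its values on defender strategies
  matter, and condition (2) makes these attacker strategies.\<close>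

definition SSE :: "'a game \<Rightarrow> ('a \<Rightarrow> real) pmf \<Rightarrow> (('a \<Rightarrow> real) pmf \<Rightarrow> 'a pmf) \<Rightarrow> bool" where
  "SSE G C g \<longleftrightarrow>
     C \<in> def_strategies G \<and>
     (\<forall>C'\<in>def_strategies G. U_d G C (g C) \<ge> U_d G C' (g C')) \<and>
     (\<forall>C'\<in>def_strategies G. att_best_response G C' (g C')) \<and>
     (\<forall>C'\<in>def_strategies G. \<forall>a. att_best_response G C' a \<longrightarrow> U_d G C' (g C') \<ge> U_d G C' a)"

definition Omega_NE :: "'a game \<Rightarrow> ('a \<Rightarrow> real) pmf set" where
  "Omega_NE G = {C. \<exists>a. NE G C a}"

definition Omega_SSE :: "'a game \<Rightarrow> ('a \<Rightarrow> real) pmf set" where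
  "Omega_SSE G = {C. \<exists>g. SSE G C g}"

definition att_best_utility :: "'a game \<Rightarrow> ('a \<Rightarrow> real) pmf \<Rightarrow> real" where
  "att_best_utility G C = Max ((\<lambda>t. U_a G C (return_pmf t)) ` targets G)"

text \<open>In a security game the infimum is a minimum: the set of defender strategies is a nonempty
  simplex, on which \<open>att_best_utility G\<close> is continuous.\<close>

definition minimax_utility :: "'a game \<Rightarrow> real" where
  "minimax_utility G = (INF C\<in>def_strategies G. att_best_utility G C)"

definition Omega_M :: "'a game \<Rightarrow> ('a \<Rightarrow> real) pmf set" where
  "Omega_M G = {C \<in> def_strategies G. att_best_utility G C = minimax_utility G}"

end

theory Submission
  imports Defs
begin

text \<open>For a fixed attack, the defender's and the attacker's utilities are affine in the marginal
  coverage, with slopes \<open>\<Delta>U\<^sub>d\<close> and \<open>-\<Delta>U\<^sub>a\<close>. Rescaling the attack probabilities by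
  \<open>\<Delta>U\<^sub>a / \<Delta>U\<^sub>d\<close> therefore turns defender best responses of the zero-sum game with payoff
  \<open>U\<^sub>a\<close> into defender best responses of the original game, without changing the support; so
  minimax strategies and Nash strategies agree by the minimax theorem. If an SSE strategy did not
  attain the minimax value, take a strategy of smaller attacker value and lower the
  coverage of the target attacked in the SSE (possible by SSAS) until it is a best response again:
  it is still covered more than before, so the defender gains, a contradiction.\<close>

section \<open>A theorem of the alternative\<close>

text \<open>The pairs \<open>(F x, H x)\<close> form a convex set that misses the open negative
  quadrant. The normal of a separating hyperplane, scaled to sum 1, supplies the weights.\<close>

lemma alternative_two:
  fixes F H :: "'v \<Rightarrow> real"
  assumes convexlike: "\<And>x y u. x \<in> X \<Longrightarrow> y \<in> X \<Longrightarrow> 0 \<le> u \<Longrightarrow> u \<le> 1 \<Longrightarrow>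
             \<exists>z\<in>X. F z = u * F x + (1 - u) * F y \<and> H z = u * H x + (1 - u) * H y"
    and nosol: "\<And>x. x \<in> X \<Longrightarrow> \<not> (F x < 0 \<and> H x < 0)"
  shows "\<exists>p q. 0 \<le> p \<and> 0 \<le> q \<and> p + q = 1 \<and> (\<forall>x\<in>X. 0 \<le> p * F x + q * H x)"
proof (cases "X = {}")
  case True
  then show ?thesis by (intro exI[of _ 1] exI[of _ 0]) auto
next
  case False
  define S where "S = {..<0::real} \<times> {..<0::real}"
  define I where "I = (\<lambda>x. (F x, H x)) ` X"
  have "convex S" unfolding S_def by (intro convex_Times convex_real_interval)
  moreover have "convex I"
    unfolding convex_alt
  proof (intro ballI allI impI)
    fix a b and u :: real assume ab: "a \<in> I" "b \<in> I" and u: "0 \<le> u \<and> u \<le> 1"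
    from ab obtain x y where x: "x \<in> X" "a = (F x, H x)" and y: "y \<in> X" "b = (F y, H y)"
      by (auto simp: I_def)
    \<comment> \<open>\<open>convex_alt\<close> puts the weight \<open>u\<close> on the second
      point, hence the exchanged order of \<open>x\<close> and \<open>y\<close>.\<close>
    obtain z where z: "z \<in> X" "F z = u * F y + (1 - u) * F x" "H z = u * H y + (1 - u) * H x"
      using convexlike[of y x u] x y u by auto
    have "(1 - u) *\<^sub>R a + u *\<^sub>R b = (F z, H z)"
      using x y z by (simp add: algebra_simps)
    then show "(1 - u) *\<^sub>R a + u *\<^sub>R b \<in> I"
      using z(1) by (auto simp: I_def)
  qed
  moreover have "S \<noteq> {}" by (auto simp: S_def intro: exI[of _ "-1"])
  moreover have "I \<noteq> {}" using False by (simp add: I_def)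
  moreover have "S \<inter> I = {}" using nosol by (auto simp: S_def I_def)
  ultimately have "\<exists>n c. n \<noteq> 0 \<and> (\<forall>s\<in>S. inner n s \<le> c) \<and> (\<forall>s\<in>I. inner n s \<ge> c)"
    by (rule separating_hyperplane_sets)
  then obtain n c where n0: "n \<noteq> 0"
    and S: "\<forall>s\<in>S. inner n s \<le> c" and I: "\<forall>s\<in>I. inner n s \<ge> c"
    by blast
  obtain p q where n: "n = (p, q)" by (cases n)
  have S': "p * a + q * b \<le> c" if "a < 0" "b < 0" for a b
    using S that by (auto simp: S_def n)
  \<comment> \<open>Letting \<open>e\<close> tend to 0 from the right extends the bound to the
    closed quadrant. Its corner yields \<open>0 \<le> c\<close>, its two edges the signs of
    \<open>p\<close> and \<open>q\<close>.\<close>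
  have le_c: "p * a + q * b \<le> c" if "a \<le> 0" "b \<le> 0" for a b
  proof (rule tendsto_le[of "at_right 0", OF _ tendsto_const])
    show "((\<lambda>e. p * (a - e) + q * (b - e)) \<longlongrightarrow> p * a + q * b) (at_right 0)"
      by (auto intro!: tendsto_eq_intros)
    show "\<forall>\<^sub>F e in at_right 0. p * (a - e) + q * (b - e) \<le> c"
      using eventually_at_right_less[of "0::real"]
      by eventually_elim (use S' that in auto)
  qed simp
  have c0: "0 \<le> c" using le_c[of 0 0] by simp
  have nonneg: "0 \<le> r" if "\<And>a. a \<le> 0 \<Longrightarrow> r * a \<le> c" for r :: real
  proof (rule ccontr)
    assume "\<not> 0 \<le> r"
    then have r: "r < 0" by simp
    \<comment> \<open>For negative \<open>r\<close> this is an admissible \<open>a\<close> with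
      \<open>r * a = c + 1\<close>, which exceeds the bound.\<close>
    have "(c + 1) / r \<le> 0" using r c0 by (simp add: divide_nonneg_neg)
    from that[OF this] show False using r by simp
  qed
  have p: "0 \<le> p" using nonneg[of p] le_c[of _ 0] by simp
  have q: "0 \<le> q" using nonneg[of q] le_c[of 0] by simp
  have pq: "0 < p + q" using n0 n p q by (auto simp: zero_prod_def)
  have pos: "0 \<le> p * F x + q * H x" if "x \<in> X" for x
  proof -
    have "c \<le> p * F x + q * H x" using I that by (auto simp: I_def n)
    with c0 show ?thesis by simp
  qed
  have "0 \<le> (p / (p + q)) * F x + (q / (p + q)) * H x" if "x \<in> X" for x
    using pos[OF that] pq by (simp add: add_divide_distrib[symmetric])
  moreover have "p / (p + q) + q / (p + q) = 1"
    using pq by (simp add: add_divide_distrib[symmetric])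
  ultimately show ?thesis
    using p q pq by (intro exI[of _ "p / (p + q)"] exI[of _ "q / (p + q)"]) auto
qed

text \<open>The convexity hypothesis is stated for the values of the functionals only, so that
  \<open>X\<close> may be a set of probability mass functions, which do not form a vector space.\<close>

lemma alternative_finite:
  fixes L :: "'t \<Rightarrow> 'v \<Rightarrow> real"
  assumes "finite T" "T \<noteq> {}"
    and "\<And>x y u. x \<in> X \<Longrightarrow> y \<in> X \<Longrightarrow> 0 \<le> u \<Longrightarrow> u \<le> 1 \<Longrightarrow>
             \<exists>z\<in>X. \<forall>t\<in>T. L t z = u * L t x + (1 - u) * L t y"
    and "\<And>x. x \<in> X \<Longrightarrow> \<exists>t\<in>T. 0 \<le> L t x"
  shows "\<exists>w. (\<forall>t\<in>T. 0 \<le> w t) \<and> sum w T = 1 \<and> (\<forall>x\<in>X. 0 \<le> (\<Sum>t\<in>T. w t * L t x))"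
  using assms
proof (induction T arbitrary: X rule: finite_ne_induct)
  case (singleton s)
  then show ?case by (intro exI[of _ "\<lambda>_. 1"]) auto
next
  case (insert s T)
  \<comment> \<open>Where \<open>L s\<close> is negative, some index in \<open>T\<close> has a
    nonnegative value, so the induction hypothesis applies to this smaller domain; hence the
    induction generalises over \<open>X\<close>.\<close>
  define X' where "X' = {x \<in> X. L s x < 0}"
  have "\<exists>w. (\<forall>t\<in>T. 0 \<le> w t) \<and> sum w T = 1 \<and> (\<forall>x\<in>X'. 0 \<le> (\<Sum>t\<in>T. w t * L t x))"
  proof (rule insert.IH)
    fix x y and u :: real assume xy: "x \<in> X'" "y \<in> X'" and u: "0 \<le> u" "u \<le> 1"
    obtain z where z: "z \<in> X" "\<forall>t\<in>insert s T. L t z = u * L t x + (1 - u) * L t y"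
      using insert.prems(1)[of x y u] xy u by (auto simp: X'_def)
    have "u * L s x + (1 - u) * L s y < 0"
      using convex_bound_lt[of "L s x" 0 "L s y" u "1 - u"] xy u by (simp add: X'_def)
    with z show "\<exists>z\<in>X'. \<forall>t\<in>T. L t z = u * L t x + (1 - u) * L t y"
      by (auto simp: X'_def)
  next
    fix x assume "x \<in> X'"
    then show "\<exists>t\<in>T. 0 \<le> L t x" using insert.prems(2)[of x] by (auto simp: X'_def)
  qed
  then obtain w where w: "\<forall>t\<in>T. 0 \<le> w t" "sum w T = 1"
    and wX': "\<forall>x\<in>X'. 0 \<le> (\<Sum>t\<in>T. w t * L t x)" by blast
  define H where "H x = (\<Sum>t\<in>T. w t * L t x)" for x
  \<comment> \<open>Wherever \<open>L s\<close> is negative, the weights \<open>w\<close> make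
    \<open>H\<close> nonnegative. The two are thus never negative together, which is the case of two
    functionals.\<close>
  have "\<exists>p q. 0 \<le> p \<and> 0 \<le> q \<and> p + q = 1 \<and> (\<forall>x\<in>X. 0 \<le> p * L s x + q * H x)"
  proof (rule alternative_two)
    fix x y and u :: real assume "x \<in> X" "y \<in> X" "0 \<le> u" "u \<le> 1"
    then obtain z where z: "z \<in> X" "\<forall>t\<in>insert s T. L t z = u * L t x + (1 - u) * L t y"
      using insert.prems(1)[of x y u] by auto
    have "H z = (\<Sum>t\<in>T. u * (w t * L t x) + (1 - u) * (w t * L t y))"
      unfolding H_def
    proof (rule sum.cong[OF refl])
      fix t assume "t \<in> T"
      with z(2) have "L t z = u * L t x + (1 - u) * L t y" by simp
      then show "w t * L t z = u * (w t * L t x) + (1 - u) * (w t * L t y)"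
        by (simp only:) (simp add: algebra_simps)
    qed
    then have "H z = u * H x + (1 - u) * H y"
      by (simp add: H_def sum.distrib sum_distrib_left)
    with z show "\<exists>z\<in>X. L s z = u * L s x + (1 - u) * L s y \<and> H z = u * H x + (1 - u) * H y"
      by auto
  next
    fix x assume "x \<in> X"
    then show "\<not> (L s x < 0 \<and> H x < 0)" using wX' by (fastforce simp: X'_def H_def)
  qed
  then obtain p q where pq: "0 \<le> p" "0 \<le> q" "p + q = 1" "\<forall>x\<in>X. 0 \<le> p * L s x + q * H x"
    by blast
  define w' where "w' t = (if t = s then p else q * w t)" for t
  have sum_w': "(\<Sum>t\<in>insert s T. w' t * f t) = p * f s + q * (\<Sum>t\<in>T. w t * f t)" for f :: "'t \<Rightarrow> real"
  proof -
    have "(\<Sum>t\<in>T. w' t * f t) = (\<Sum>t\<in>T. q * (w t * f t))"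
      using insert.hyps by (intro sum.cong) (auto simp: w'_def)
    then show ?thesis using insert.hyps by (simp add: w'_def sum_distrib_left)
  qed
  have "sum w' (insert s T) = 1" using sum_w'[of "\<lambda>_. 1"] w pq by simp
  moreover have "\<forall>x\<in>X. 0 \<le> (\<Sum>t\<in>insert s T. w' t * L t x)"
    using pq(4) by (simp add: sum_w' H_def)
  moreover have "\<forall>t\<in>insert s T. 0 \<le> w' t" using w pq by (auto simp: w'_def)
  ultimately show ?case by blast
qed

section \<open>Probability mass functions\<close>

text \<open>The convex combination with weights \<open>u\<close> and \<open>1 - u\<close>, encoded
  as a biased coin that selects the distribution to sample from.\<close>

definition mix_pmf :: "real \<Rightarrow> 'b pmf \<Rightarrow> 'b pmf \<Rightarrow> 'b pmf" where
  "mix_pmf u p q = bernoulli_pmf u \<bind> (\<lambda>b. if b then p else q)"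

lemma pmf_mix_pmf:
  assumes "0 \<le> u" "u \<le> 1"
  shows "pmf (mix_pmf u p q) x = u * pmf p x + (1 - u) * pmf q x"
  using assms by (simp add: mix_pmf_def pmf_bind)

lemma set_mix_pmf_subset: "set_pmf (mix_pmf u p q) \<subseteq> set_pmf p \<union> set_pmf q"
  by (auto simp: mix_pmf_def split: if_splits)

lemma pmf_of_weights:
  fixes w :: "'b \<Rightarrow> real"
  assumes "finite T" "\<And>t. t \<in> T \<Longrightarrow> 0 \<le> w t" "sum w T = 1"
  obtains p where "set_pmf p \<subseteq> T" "\<And>t. t \<in> T \<Longrightarrow> pmf p t = w t"
proof -
  \<comment> \<open>Nothing is known of \<open>w\<close> outside \<open>T\<close>, so it is cut off
    to 0 there before \<open>embed_pmf\<close> is applied.\<close>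
  define f where "f t = (if t \<in> T then w t else 0)" for t
  have f0: "0 \<le> f t" for t using assms(2) by (simp add: f_def)
  have "(\<integral>\<^sup>+ t. ennreal (f t) \<partial>count_space UNIV) = (\<Sum>t\<in>T. ennreal (f t))"
    using assms(1) by (intro nn_integral_count_space'[of T]) (auto simp: f_def)
  also have "\<dots> = ennreal (sum f T)" using f0 by (simp add: sum_ennreal)
  also have "sum f T = 1" using assms(3) by (simp add: f_def)
  finally have "(\<integral>\<^sup>+ t. ennreal (f t) \<partial>count_space UNIV) = 1" by simp
  then have pmf: "pmf (embed_pmf f) t = f t" for t
    using f0 by (intro pmf_embed_pmf) auto
  show thesis
  proof
    show "set_pmf (embed_pmf f) \<subseteq> T" by (auto simp: set_pmf_eq pmf f_def)
    show "pmf (embed_pmf f) t = w t" if "t \<in> T" for t using that by (simp add: pmf f_def)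
  qed
qed

section \<open>Strategies of a security game\<close>

text \<open>For a target \<open>t\<close> this is \<open>U_a\<close> at the pure attack
  \<open>return_pmf t\<close>; mixed attacks average it.\<close>

definition att_payoff :: "'a game \<Rightarrow> ('a \<Rightarrow> real) pmf \<Rightarrow> 'a \<Rightarrow> real" where
  "att_payoff G C t = marginal G C t * att_cov G t + (1 - marginal G C t) * att_unc G t"

definition def_payoff :: "'a game \<Rightarrow> ('a \<Rightarrow> real) pmf \<Rightarrow> 'a \<Rightarrow> real" where
  "def_payoff G C t = marginal G C t * def_cov G t + (1 - marginal G C t) * def_unc G t"

text \<open>Here and in \<open>def_payoff_diff\<close> the same marginal gap appears, with
  \<open>C\<close> and \<open>C'\<close> exchanged on the left. Attacker losses and defender gains
  are therefore proportional target by target.\<close>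

lemma att_payoff_diff:
  "att_payoff G C' t - att_payoff G C t =
     (marginal G C t - marginal G C' t) * (att_unc G t - att_cov G t)"
  by (simp add: att_payoff_def algebra_simps)

lemma def_payoff_diff:
  "def_payoff G C t - def_payoff G C' t =
     (marginal G C t - marginal G C' t) * (def_cov G t - def_unc G t)"
  by (simp add: def_payoff_def algebra_simps)

lemma U_a_eq: "U_a G C a = (\<Sum>t\<in>targets G. pmf a t * att_payoff G C t)"
  by (simp add: U_a_def att_payoff_def)

lemma U_d_eq: "U_d G C a = (\<Sum>t\<in>targets G. pmf a t * def_payoff G C t)"
  by (simp add: U_d_def def_payoff_def)

context
  fixes G :: "'a game"
  assumes game: "security_game G"
begin

lemma finite_targets: "finite (targets G)"
  and targets_nonempty: "targets G \<noteq> {}"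
  and schedule_subset: "i \<in> {1..num_resources G} \<Longrightarrow> s \<in> schedules G i \<Longrightarrow> s \<subseteq> targets G"
  and delta_def_pos: "t \<in> targets G \<Longrightarrow> 0 < def_cov G t - def_unc G t"
  and delta_att_pos: "t \<in> targets G \<Longrightarrow> 0 < att_unc G t - att_cov G t"
  using game by (auto simp: security_game_def)

section \<open>Coverage vectors and marginal coverage\<close>

lemma finite_coverage_vectors: "finite (coverage_vectors G)"
proof (rule finite_subset)
  show "coverage_vectors G \<subseteq> indicator ` Pow (targets G)"
  proof
    fix d assume "d \<in> coverage_vectors G"
    then obtain s where s: "\<forall>i\<in>{1..num_resources G}. s i \<in> schedules G i"
      and d: "d = indicator (\<Union>i\<in>{1..num_resources G}. s i)"
      unfolding coverage_vectors_def by blast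
    have "(\<Union>i\<in>{1..num_resources G}. s i) \<subseteq> targets G"
      using s schedule_subset by blast
    then show "d \<in> indicator ` Pow (targets G)" unfolding d by (intro imageI PowI)
  qed
qed (simp add: finite_targets)

lemma sum_pmf_coverage_vectors:
  "C \<in> def_strategies G \<Longrightarrow> (\<Sum>d\<in>coverage_vectors G. pmf C d) = 1"
  by (simp add: def_strategies_def sum_pmf_eq_1 finite_coverage_vectors)

lemma sum_pmf_targets: "a \<in> att_strategies G \<Longrightarrow> (\<Sum>t\<in>targets G. pmf a t) = 1"
  by (simp add: att_strategies_def sum_pmf_eq_1 finite_targets)

lemma coverage_vector_bounds: "d \<in> coverage_vectors G \<Longrightarrow> 0 \<le> d t \<and> d t \<le> 1"
  by (auto simp: coverage_vectors_def indicator_def)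

lemma marginal_nonneg: "0 \<le> marginal G C t"
  unfolding marginal_def using coverage_vector_bounds by (intro sum_nonneg) auto

lemma marginal_le_1:
  assumes "C \<in> def_strategies G"
  shows "marginal G C t \<le> 1"
proof -
  have "marginal G C t \<le> (\<Sum>d\<in>coverage_vectors G. pmf C d)"
    unfolding marginal_def using coverage_vector_bounds
    by (intro sum_mono) (auto intro: mult_left_le_one_le)
  then show ?thesis using sum_pmf_coverage_vectors[OF assms] by simp
qed

lemma mix_pmf_def_strategies:
  "C \<in> def_strategies G \<Longrightarrow> C' \<in> def_strategies G \<Longrightarrow> mix_pmf u C C' \<in> def_strategies G"
  using set_mix_pmf_subset[of u C C'] by (auto simp: def_strategies_def)

lemma marginal_mix_pmf:
  assumes "0 \<le> u" "u \<le> 1"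
  shows "marginal G (mix_pmf u C C') t = u * marginal G C t + (1 - u) * marginal G C' t"
  by (simp add: marginal_def pmf_mix_pmf[OF assms] sum_distrib_left sum.distrib[symmetric]
      algebra_simps)

text \<open>In this form marginals can be computed through \<open>map_pmf\<close>, as
  \<open>lower_coverage\<close> does after uncovering a target.\<close>

lemma marginal_eq_expectation:
  assumes "C \<in> def_strategies G"
  shows "marginal G C t = measure_pmf.expectation C (\<lambda>d. d t)"
proof -
  have "measure_pmf.expectation C (\<lambda>d. d t) = (\<Sum>d\<in>coverage_vectors G. d t * pmf C d)"
    using assms by (intro integral_measure_pmf_real finite_coverage_vectors)
      (auto simp: def_strategies_def)
  then show ?thesis by (simp add: marginal_def)
qed

text \<open>This is where SSAS enters: deleting \<open>t\<close> from the schedule of every resource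
  leaves admissible schedules.\<close>

lemma coverage_vectors_uncover:
  assumes "SSAS G" "d \<in> coverage_vectors G"
  shows "d(t := 0) \<in> coverage_vectors G"
proof -
  from assms(2) obtain s where s: "\<forall>i\<in>{1..num_resources G}. s i \<in> schedules G i"
    and d: "d = indicator (\<Union>i\<in>{1..num_resources G}. s i)"
    by (auto simp: coverage_vectors_def)
  have "d(t := 0) = indicator (\<Union>i\<in>{1..num_resources G}. s i - {t})"
    by (auto simp: d indicator_def)
  moreover have "\<forall>i\<in>{1..num_resources G}. s i - {t} \<in> schedules G i"
    using assms(1) s unfolding SSAS_def by blast
  ultimately show ?thesis
    unfolding coverage_vectors_def by (intro CollectI exI[of _ "\<lambda>i. s i - {t}"]) auto
qed

text \<open>Mixing \<open>C\<close> with its version that never covers \<open>t\<close> scales the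
  marginal of \<open>t\<close> alone, since both agree on all other targets.\<close>

lemma lower_coverage:
  assumes "SSAS G" "C \<in> def_strategies G" "0 \<le> m" "m \<le> marginal G C t"
  obtains C' where "C' \<in> def_strategies G" "marginal G C' t = m"
    "\<And>s. s \<noteq> t \<Longrightarrow> marginal G C' s = marginal G C s"
proof -
  define C0 where "C0 = map_pmf (\<lambda>d. d(t := 0)) C"
  have C0: "C0 \<in> def_strategies G"
    using assms(1,2) coverage_vectors_uncover by (auto simp: C0_def def_strategies_def)
  have C0_t: "marginal G C0 t = 0" and C0_s: "s \<noteq> t \<Longrightarrow> marginal G C0 s = marginal G C s" for s
    using marginal_eq_expectation[OF C0] marginal_eq_expectation[OF assms(2)] by (simp_all add: C0_def)
  \<comment> \<open>The solution of \<open>u * marginal G C t = m\<close>. If the marginal is 0 then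
    so is \<open>m\<close>, and the default 0 works.\<close>
  define u where "u = (if marginal G C t = 0 then 0 else m / marginal G C t)"
  have u: "0 \<le> u" "u \<le> 1" using assms(3,4) marginal_nonneg[of C t] by (auto simp: u_def)
  show thesis
  proof
    show "mix_pmf u C C0 \<in> def_strategies G"
      using assms(2) C0 by (rule mix_pmf_def_strategies)
    show "marginal G (mix_pmf u C C0) t = m"
      using assms(3,4) unfolding marginal_mix_pmf[OF u] C0_t by (simp add: u_def)
    show "marginal G (mix_pmf u C C0) s = marginal G C s" if "s \<noteq> t" for s
      using that by (simp add: marginal_mix_pmf[OF u] C0_s algebra_simps)
  qed
qed

section \<open>Attacker payoffs and best responses\<close>

lemma return_pmf_att_strategies: "t \<in> targets G \<Longrightarrow> return_pmf t \<in> att_strategies G"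
  by (simp add: att_strategies_def)

lemma U_a_return_pmf: "t \<in> targets G \<Longrightarrow> U_a G C (return_pmf t) = att_payoff G C t"
  and U_d_return_pmf: "t \<in> targets G \<Longrightarrow> U_d G C (return_pmf t) = def_payoff G C t"
  by (simp_all add: U_a_eq U_d_eq indicator_def finite_targets if_distrib[of "\<lambda>x. x * _"]
      cong: if_cong)

lemma att_best_utility_eq: "att_best_utility G C = Max (att_payoff G C ` targets G)"
  unfolding att_best_utility_def by (intro arg_cong[of _ _ Max] image_cong) (auto simp: U_a_return_pmf)

lemma att_payoff_le: "t \<in> targets G \<Longrightarrow> att_payoff G C t \<le> att_best_utility G C"
  by (simp add: att_best_utility_eq finite_targets)

lemma att_best_utility_attained: "\<exists>t\<in>targets G. att_payoff G C t = att_best_utility G C"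
proof -
  have "att_best_utility G C \<in> att_payoff G C ` targets G"
    unfolding att_best_utility_eq by (rule Max_in) (simp_all add: finite_targets targets_nonempty)
  then show ?thesis by force
qed

lemma U_a_le_att_best_utility:
  assumes "a \<in> att_strategies G"
  shows "U_a G C a \<le> att_best_utility G C"
proof -
  have "U_a G C a \<le> (\<Sum>t\<in>targets G. pmf a t * att_best_utility G C)"
    unfolding U_a_eq by (intro sum_mono mult_left_mono att_payoff_le) auto
  also have "\<dots> = att_best_utility G C"
    by (simp add: sum_distrib_right[symmetric] sum_pmf_targets[OF assms])
  finally show ?thesis .
qed

text \<open>An average of pure payoffs reaches their maximum exactly when no weight falls on a
  suboptimal target.\<close>

lemma att_best_response_iff:
  "att_best_response G C a \<longleftrightarrow>
     a \<in> att_strategies G \<and> (\<forall>t\<in>set_pmf a. att_payoff G C t = att_best_utility G C)"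
    (is "?L \<longleftrightarrow> ?R")
proof
  assume L: ?L
  then have a: "a \<in> att_strategies G" by (simp add: att_best_response_def)
  obtain t0 where "t0 \<in> targets G" "att_payoff G C t0 = att_best_utility G C"
    using att_best_utility_attained by blast
  then have "att_best_utility G C \<le> U_a G C a"
    using L return_pmf_att_strategies U_a_return_pmf unfolding att_best_response_def by metis
  \<comment> \<open>The total weighted shortfall from the maximum is at most 0, while each of its
    terms is nonnegative, so every term vanishes.\<close>
  then have "(\<Sum>t\<in>targets G. pmf a t * (att_best_utility G C - att_payoff G C t)) \<le> 0"
    by (simp add: U_a_eq right_diff_distrib sum_subtractf sum_distrib_right[symmetric]
        sum_pmf_targets[OF a])
  moreover have nn: "\<And>t. t \<in> targets G \<Longrightarrow> 0 \<le> pmf a t * (att_best_utility G C - att_payoff G C t)"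
    using att_payoff_le by simp
  ultimately have "(\<Sum>t\<in>targets G. pmf a t * (att_best_utility G C - att_payoff G C t)) = 0"
    by (intro antisym sum_nonneg)
  then have "\<forall>t\<in>targets G. pmf a t * (att_best_utility G C - att_payoff G C t) = 0"
    by (subst (asm) sum_nonneg_eq_0_iff[OF finite_targets nn])
  with a show ?R by (fastforce simp: att_strategies_def set_pmf_iff)
next
  assume R: ?R
  have "U_a G C a = (\<Sum>t\<in>targets G. pmf a t * att_best_utility G C)"
    unfolding U_a_eq using R by (intro sum.cong) (auto simp: set_pmf_iff)
  also have "\<dots> = att_best_utility G C"
    using R by (simp add: sum_distrib_right[symmetric] sum_pmf_targets)
  finally show ?L
    using R U_a_le_att_best_utility by (simp add: att_best_response_def)
qed

section \<open>The minimax value\<close>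

lemma bdd_below_att_best_utility: "bdd_below (att_best_utility G ` def_strategies G)"
proof -
  obtain t where t: "t \<in> targets G" using targets_nonempty by blast
  \<comment> \<open>Marginals are at most 1, so the fully covered payoff of one fixed target bounds
    the attacker's value from below; this makes the real infimum a lower bound.\<close>
  have "att_cov G t \<le> att_best_utility G C" if "C \<in> def_strategies G" for C
  proof -
    have "0 \<le> (1 - marginal G C t) * (att_unc G t - att_cov G t)"
      using marginal_le_1[OF that] delta_att_pos[OF t] by simp
    then have "att_cov G t \<le> att_payoff G C t" by (simp add: att_payoff_def algebra_simps)
    also note att_payoff_le[OF t]
    finally show ?thesis .
  qed
  then show ?thesis by (rule bdd_belowI2)
qed

lemma minimax_utility_le: "C \<in> def_strategies G \<Longrightarrow> minimax_utility G \<le> att_best_utility G C"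
  unfolding minimax_utility_def by (rule cINF_lower[OF bdd_below_att_best_utility])

text \<open>Reduces minimaxity to pairwise comparison, so attainment of the infimum needs no
  separate argument.\<close>

lemma Omega_M_I:
  assumes "C \<in> def_strategies G"
    and "\<And>C'. C' \<in> def_strategies G \<Longrightarrow> att_best_utility G C \<le> att_best_utility G C'"
  shows "C \<in> Omega_M G"
proof -
  have "att_best_utility G C \<le> minimax_utility G"
    unfolding minimax_utility_def using assms by (intro cINF_greatest) auto
  with minimax_utility_le[OF assms(1)] assms(1) show ?thesis by (simp add: Omega_M_def)
qed

section \<open>Strong Stackelberg equilibria\<close>

lemma SSE_minimax:
  assumes "SSAS G" "SSE G C g"
  shows "C \<in> Omega_M G"
proof (rule Omega_M_I)
  show C: "C \<in> def_strategies G" using assms(2) by (simp add: SSE_def)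
  fix C' assume C': "C' \<in> def_strategies G"
  show "att_best_utility G C \<le> att_best_utility G C'"
  proof (rule ccontr)
    assume "\<not> ?thesis"
    then have less: "att_best_utility G C' < att_best_utility G C" by simp
    have br: "att_best_response G C (g C)" using assms(2) C by (simp add: SSE_def)
    then have gC: "g C \<in> att_strategies G" by (simp add: att_best_response_def)
    \<comment> \<open>The response \<open>g C\<close> may be mixed. Some target in its support pays
      the defender at least the average, and it serves as the attacked target below.\<close>
    have "\<exists>t\<in>set_pmf (g C). U_d G C (g C) \<le> def_payoff G C t"
    proof (rule ccontr)
      assume neg: "\<not> ?thesis"
      have "(\<Sum>t\<in>targets G. pmf (g C) t * def_payoff G C t) < (\<Sum>t\<in>targets G. pmf (g C) t * U_d G C (g C))"
      proof (rule sum_strict_mono_ex1[OF finite_targets])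
        show "\<forall>t\<in>targets G. pmf (g C) t * def_payoff G C t \<le> pmf (g C) t * U_d G C (g C)"
        proof
          fix t assume "t \<in> targets G"
          show "pmf (g C) t * def_payoff G C t \<le> pmf (g C) t * U_d G C (g C)"
            using neg by (cases "t \<in> set_pmf (g C)")
              (force intro: mult_left_mono, simp add: set_pmf_iff)
        qed
        obtain t where "t \<in> set_pmf (g C)" using set_pmf_not_empty by fast
        then show "\<exists>t\<in>targets G. pmf (g C) t * def_payoff G C t < pmf (g C) t * U_d G C (g C)"
          using neg gC by (auto simp: att_strategies_def not_le pmf_positive intro!: bexI[of _ t] mult_strict_left_mono)
      qed
      then show False
        by (simp add: U_d_eq[symmetric] sum_distrib_right[symmetric] sum_pmf_targets[OF gC])
    qed
    then obtain t where t_supp: "t \<in> set_pmf (g C)" and t_ge: "U_d G C (g C) \<le> def_payoff G C t"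
      by blast
    have t: "t \<in> targets G" using t_supp gC by (auto simp: att_strategies_def)
    have t_att: "att_payoff G C t = att_best_utility G C"
      using br t_supp by (simp add: att_best_response_iff)
    define \<delta> where "\<delta> = att_unc G t - att_cov G t"
    have \<delta>: "0 < \<delta>" using delta_att_pos[OF t] by (simp add: \<delta>_def)
    \<comment> \<open>the coverage of \<open>t\<close> that makes its attack worth exactly \<open>att_best_utility G C'\<close>\<close>
    define m where "m = (att_unc G t - att_best_utility G C') / \<delta>"
    have payoff: "att_payoff G D t = att_unc G t - marginal G D t * \<delta>" for D
      by (simp add: att_payoff_def \<delta>_def algebra_simps)
    \<comment> \<open>Under \<open>C\<close> attacking \<open>t\<close> is worth more than
      \<open>att_best_utility G C'\<close>, so hitting that value takes more coverage. Under
      \<open>C'\<close> it is worth at most that value, which gives \<open>m_le\<close>.\<close>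
    have m_gt: "marginal G C t < m"
      using less t_att \<delta> by (simp add: m_def payoff pos_less_divide_eq)
    have m_le: "m \<le> marginal G C' t"
      using att_payoff_le[OF t, of C'] \<delta> by (simp add: m_def payoff pos_divide_le_eq)
    have "0 \<le> m" using m_gt marginal_nonneg[of C t] by linarith
    then obtain D where D: "D \<in> def_strategies G" "marginal G D t = m"
      and D_other: "\<And>s. s \<noteq> t \<Longrightarrow> marginal G D s = marginal G C' s"
      using lower_coverage[OF assms(1) C' _ m_le] by blast
    have D_t: "att_payoff G D t = att_best_utility G C'"
      using D(2) \<delta> by (simp add: payoff m_def)
    \<comment> \<open>Uncovering raises the payoff of \<open>t\<close> only up to the old maximum
      and leaves the other payoffs alone, so the maximum does not grow.\<close>
    have "att_payoff G D s \<le> att_best_utility G C'" if "s \<in> targets G" for s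
      using D_t D_other[of s] att_payoff_le[OF that, of C'] by (cases "s = t") (auto simp: att_payoff_def)
    then have "att_best_utility G D \<le> att_best_utility G C'"
      using att_best_utility_attained[of D] by force
    then have "att_best_utility G D = att_payoff G D t"
      using D_t att_payoff_le[OF t, of D] by simp
    then have "att_best_response G D (return_pmf t)"
      using t by (simp add: att_best_response_iff return_pmf_att_strategies)
    \<comment> \<open>Tie-breaking in favour of the defender makes \<open>g D\<close> at least as
      good as the pure attack on \<open>t\<close>; optimality of \<open>C\<close> then closes the
      chain against the strict gain in coverage.\<close>
    then have "def_payoff G D t \<le> U_d G D (g D)"
      using assms(2) D(1) U_d_return_pmf[OF t, of D] by (force simp: SSE_def)
    also have "\<dots> \<le> U_d G C (g C)" using assms(2) D(1) by (simp add: SSE_def)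
    also have "\<dots> \<le> def_payoff G C t" by (rule t_ge)
    also have "def_payoff G C t < def_payoff G D t"
    proof -
      have "0 < (marginal G D t - marginal G C t) * (def_cov G t - def_unc G t)"
        using m_gt D(2) delta_def_pos[OF t] by simp
      then show ?thesis using def_payoff_diff[of G D t C] by simp
    qed
    finally show False by simp
  qed
qed

section \<open>Nash equilibria and the minimax theorem\<close>

lemma NE_minimax:
  assumes "NE G C a"
  shows "C \<in> Omega_M G"
proof (rule Omega_M_I)
  show C: "C \<in> def_strategies G" using assms by (simp add: NE_def)
  have a: "a \<in> att_strategies G" using assms by (simp add: NE_def)
  fix C' assume C': "C' \<in> def_strategies G"
  \<comment> \<open>Chosen so that \<open>w t\<close> times the attacker slope equals
    \<open>pmf a t\<close> times the defender slope. The weights are not normalised; a positive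
    total suffices.\<close>
  define w where "w t = pmf a t * (def_cov G t - def_unc G t) / (att_unc G t - att_cov G t)" for t
  have w0: "0 \<le> w t" if "t \<in> targets G" for t
    using delta_def_pos[OF that] delta_att_pos[OF that] by (simp add: w_def)
  have w_pos: "0 < sum w (targets G)"
  proof -
    obtain t where t: "t \<in> set_pmf a" using set_pmf_not_empty by fast
    then have tT: "t \<in> targets G" using a by (auto simp: att_strategies_def)
    have "0 < w t"
      using pmf_positive[OF t] delta_def_pos[OF tT] delta_att_pos[OF tT] by (simp add: w_def)
    then show ?thesis using finite_targets tT w0 by (intro sum_pos2[of _ t]) auto
  qed
  have supp: "\<forall>t\<in>set_pmf a. att_payoff G C t = att_best_utility G C"
    using assms att_best_response_iff[of C a] by (simp add: NE_def att_best_response_def)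
  have "0 \<le> U_d G C a - U_d G C' a" using assms C' by (simp add: NE_def)
  also have "\<dots> = (\<Sum>t\<in>targets G. pmf a t * (def_payoff G C t - def_payoff G C' t))"
    by (simp add: U_d_eq sum_subtractf right_diff_distrib)
  also have "\<dots> = (\<Sum>t\<in>targets G. w t * (att_payoff G C' t - att_payoff G C t))"
  proof (rule sum.cong[OF refl])
    fix t assume "t \<in> targets G"
    from delta_att_pos[OF this]
    show "pmf a t * (def_payoff G C t - def_payoff G C' t) = w t * (att_payoff G C' t - att_payoff G C t)"
      by (simp add: w_def def_payoff_diff att_payoff_diff)
  qed
  \<comment> \<open>Off the support of \<open>a\<close> the weight is 0; on it the payoff under
    \<open>C\<close> is maximal.\<close>
  also have "\<dots> = (\<Sum>t\<in>targets G. w t * (att_payoff G C' t - att_best_utility G C))"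
    using supp by (intro sum.cong) (auto simp: w_def set_pmf_iff)
  also have "\<dots> \<le> (\<Sum>t\<in>targets G. w t * (att_best_utility G C' - att_best_utility G C))"
    using w0 att_payoff_le by (intro sum_mono mult_left_mono) auto
  also have "\<dots> = sum w (targets G) * (att_best_utility G C' - att_best_utility G C)"
    by (simp add: sum_distrib_right)
  finally show "att_best_utility G C \<le> att_best_utility G C'"
    using w_pos by (simp add: zero_le_mult_iff)
qed

text \<open>An optimal attack in the zero-sum game with payoff \<open>U_a\<close>. Every defender
  strategy leaves some target worth at least the minimax value, so the theorem of the alternative
  applies to payoffs shifted by that value.\<close>

lemma minimax_attack_weights:
  obtains w where "\<And>t. t \<in> targets G \<Longrightarrow> 0 \<le> w t" "sum w (targets G) = 1"
    "\<And>C. C \<in> def_strategies G \<Longrightarrow> minimax_utility G \<le> (\<Sum>t\<in>targets G. w t * att_payoff G C t)"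
proof -
  define L where "L t C = att_payoff G C t - minimax_utility G" for t C
  have "\<exists>w. (\<forall>t\<in>targets G. 0 \<le> w t) \<and> sum w (targets G) = 1 \<and>
          (\<forall>C\<in>def_strategies G. 0 \<le> (\<Sum>t\<in>targets G. w t * L t C))"
  proof (rule alternative_finite[OF finite_targets targets_nonempty])
    fix C C' and u :: real
    assume "C \<in> def_strategies G" "C' \<in> def_strategies G" and u: "0 \<le> u" "u \<le> 1"
    then have "mix_pmf u C C' \<in> def_strategies G" by (simp add: mix_pmf_def_strategies)
    moreover have "L t (mix_pmf u C C') = u * L t C + (1 - u) * L t C'" for t
      by (simp add: L_def att_payoff_def marginal_mix_pmf[OF u] algebra_simps)
    ultimately show "\<exists>D\<in>def_strategies G. \<forall>t\<in>targets G. L t D = u * L t C + (1 - u) * L t C'"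
      by blast
  next
    fix C assume "C \<in> def_strategies G"
    then show "\<exists>t\<in>targets G. 0 \<le> L t C"
      using minimax_utility_le[of C] att_best_utility_attained[of C] by (force simp: L_def)
  qed
  then obtain w where w: "\<forall>t\<in>targets G. 0 \<le> w t" "sum w (targets G) = 1"
    and pos: "\<forall>C\<in>def_strategies G. 0 \<le> (\<Sum>t\<in>targets G. w t * L t C)" by blast
  have "(\<Sum>t\<in>targets G. w t * L t C) = (\<Sum>t\<in>targets G. w t * att_payoff G C t) - minimax_utility G" for C
    using w(2) by (simp add: L_def right_diff_distrib sum_subtractf sum_distrib_right[symmetric])
  with w pos show thesis by (intro that[of w]) auto
qed

lemma minimax_NE:
  assumes "C \<in> Omega_M G"
  shows "\<exists>a. NE G C a"
proof -
  have C: "C \<in> def_strategies G" and E: "att_best_utility G C = minimax_utility G"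
    using assms by (simp_all add: Omega_M_def)
  obtain w where w0: "\<And>t. t \<in> targets G \<Longrightarrow> 0 \<le> w t" and w1: "sum w (targets G) = 1"
    and w: "\<And>C'. C' \<in> def_strategies G \<Longrightarrow> minimax_utility G \<le> (\<Sum>t\<in>targets G. w t * att_payoff G C' t)"
    using minimax_attack_weights by blast
  have nn: "0 \<le> w t * (att_best_utility G C - att_payoff G C t)" if "t \<in> targets G" for t
    using w0[OF that] att_payoff_le[OF that, of C] by simp
  \<comment> \<open>Complementary slackness: the \<open>w\<close>-average under \<open>C\<close> is
    at least the minimax value, which is also the largest payoff, so \<open>w\<close> charges only
    targets of maximal payoff.\<close>
  have "(\<Sum>t\<in>targets G. w t * (att_best_utility G C - att_payoff G C t)) \<le> 0"
    using w[OF C] by (simp add: right_diff_distrib sum_subtractf sum_distrib_right[symmetric] w1 E)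
  then have "(\<Sum>t\<in>targets G. w t * (att_best_utility G C - att_payoff G C t)) = 0"
    using nn by (intro antisym sum_nonneg)
  then have "\<forall>t\<in>targets G. w t * (att_best_utility G C - att_payoff G C t) = 0"
    by (subst (asm) sum_nonneg_eq_0_iff[OF finite_targets nn])
  then have supp: "att_payoff G C t = att_best_utility G C" if "t \<in> targets G" "w t \<noteq> 0" for t
    using that by force
  have UaC: "(\<Sum>t\<in>targets G. w t * att_payoff G C t) = minimax_utility G"
  proof -
    have "(\<Sum>t\<in>targets G. w t * att_payoff G C t) = (\<Sum>t\<in>targets G. w t * att_best_utility G C)"
      using supp by (intro sum.cong) auto
    then show ?thesis by (simp add: sum_distrib_right[symmetric] w1 E)
  qed
  \<comment> \<open>The inverse of the rescaling in \<open>NE_minimax\<close>; division by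
    \<open>V\<close> turns it into a distribution with the same support as \<open>w\<close>.\<close>
  define v where "v t = w t * (att_unc G t - att_cov G t) / (def_cov G t - def_unc G t)" for t
  define V where "V = sum v (targets G)"
  have v0: "0 \<le> v t" if "t \<in> targets G" for t
    using w0[OF that] delta_def_pos[OF that] delta_att_pos[OF that] by (simp add: v_def)
  have V: "0 < V"
  proof -
    obtain t where t: "t \<in> targets G" "w t \<noteq> 0"
      using w1 by (metis sum.neutral zero_neq_one)
    have "0 < v t"
      using t w0[OF t(1)] delta_def_pos[OF t(1)] delta_att_pos[OF t(1)] by (simp add: v_def)
    then show ?thesis
      unfolding V_def using finite_targets t v0 by (intro sum_pos2[of _ t]) auto
  qed
  obtain a where a: "set_pmf a \<subseteq> targets G" and pmf_a: "\<And>t. t \<in> targets G \<Longrightarrow> pmf a t = v t / V"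
  proof (rule pmf_of_weights[OF finite_targets, of "\<lambda>t. v t / V"])
    show "(\<Sum>t\<in>targets G. v t / V) = 1"
      using V by (simp add: sum_divide_distrib[symmetric] V_def[symmetric])
  qed (use v0 V in auto)
  have "\<forall>t\<in>set_pmf a. att_payoff G C t = att_best_utility G C"
  proof
    fix t assume t: "t \<in> set_pmf a"
    then have "t \<in> targets G" using a by blast
    with t show "att_payoff G C t = att_best_utility G C"
      using pmf_a[of t] supp[of t] by (auto simp: set_pmf_iff v_def)
  qed
  then have "att_best_response G C a"
    using a by (simp add: att_best_response_iff att_strategies_def)
  moreover have "U_d G C' a \<le> U_d G C a" if C': "C' \<in> def_strategies G" for C'
  proof -
    have "U_d G C a - U_d G C' a = (\<Sum>t\<in>targets G. pmf a t * (def_payoff G C t - def_payoff G C' t))"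
      by (simp add: U_d_eq sum_subtractf right_diff_distrib)
    also have "\<dots> = (\<Sum>t\<in>targets G. w t * (att_payoff G C' t - att_payoff G C t) / V)"
    proof (rule sum.cong[OF refl])
      fix t assume t: "t \<in> targets G"
      from delta_def_pos[OF t]
      show "pmf a t * (def_payoff G C t - def_payoff G C' t) = w t * (att_payoff G C' t - att_payoff G C t) / V"
        by (simp add: pmf_a[OF t] v_def def_payoff_diff att_payoff_diff)
    qed
    also have "\<dots> = ((\<Sum>t\<in>targets G. w t * att_payoff G C' t) - minimax_utility G) / V"
      by (simp add: sum_divide_distrib[symmetric] right_diff_distrib sum_subtractf UaC)
    \<comment> \<open>Against the optimal weights \<open>w\<close> no \<open>C'\<close> pushes the
      average below the minimax value.\<close>
    also have "\<dots> \<ge> 0" using w[OF C'] V by simp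
    finally show ?thesis by simp
  qed
  ultimately have "NE G C a"
    using C by (simp add: NE_def att_best_response_def)
  then show ?thesis by blast
qed

end

theorem theorem3p8:
  fixes G :: "'a game"
  assumes "security_game G" and "SSAS G"
  shows "(\<forall>C\<in>Omega_SSE G. att_best_utility G C = minimax_utility G) \<and>
         Omega_SSE G \<subseteq> Omega_M G \<and> Omega_M G = Omega_NE G"
proof -
  have "Omega_SSE G \<subseteq> Omega_M G"
    using SSE_minimax[OF assms] by (auto simp: Omega_SSE_def)
  moreover have "Omega_M G = Omega_NE G"
    using NE_minimax[OF assms(1)] minimax_NE[OF assms(1)] by (auto simp: Omega_NE_def)
  ultimately show ?thesis by (auto simp: Omega_M_def)
qed

end
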